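(* Let $n$ be a positive integer of the form $n = 2^k - 1$. Then for all positive integers $a, b, c$, the tripod nim position $(n,(a,b,c))$ is a $\mathcal{P}$-position if and only if $a \oplus b \oplus c = 0$ or $a = b = c = n$.
   Context: Tree nim: a position is a finite tree whose vertices carry positive integer sizes; a leaf is a vertex of degree at most $1$; a move chooses a leaf and decreases its size by a positive integer, deleting that vertex if its size becomes $0$ (so inner vertices become playable once they become leaves); normal play (the player unable to move loses). A position is $\mathcal{P}$ iff no move leads to a $\mathcal{P}$-position. Tripod nim: $(o,(a,b,c))$ denotes the tree nim position consisting of a central vertex of size $o$ adjacent to three leaves of sizes $a$, $b$, $c$. $\oplus$ denotes nim-sum: bitwise XOR of binary expansions (binary addition without carrying). *)

theory Defs
  imports Main
begin

unbundle bit_operations_syntax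

record 'v position =
  verts :: "'v set"
  edges :: "'v set set"
  vsize :: "'v \<Rightarrow> nat"

definition simple_graph :: "'v position \<Rightarrow> bool" where
  "simple_graph p \<longleftrightarrow> finite (verts p) \<and> (\<forall>e \<in> edges p. e \<subseteq> verts p \<and> card e = 2)"

definition adj_rel :: "'v position \<Rightarrow> ('v \<times> 'v) set" where
  "adj_rel p = {(u, v). {u, v} \<in> edges p}"

definition graph_connected :: "'v position \<Rightarrow> bool" where
  "graph_connected p \<longleftrightarrow> (\<forall>u \<in> verts p. \<forall>v \<in> verts p. (u, v) \<in> (adj_rel p)\<^sup>*)"

definition graph_cycle :: "'v position \<Rightarrow> 'v list \<Rightarrow> bool" where
  "graph_cycle p xs \<longleftrightarrow> length xs \<ge> 3 \<and> distinct xs \<and>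
     (\<forall>i < length xs. {xs ! i, xs ! (Suc i mod length xs)} \<in> edges p)"

text \<open>The empty graph counts as a tree here: it is the position reached when the last vertex
  has been deleted.\<close>

definition is_tree :: "'v position \<Rightarrow> bool" where
  "is_tree p \<longleftrightarrow> simple_graph p \<and> graph_connected p \<and> (\<nexists>xs. graph_cycle p xs)"

definition degree :: "'v position \<Rightarrow> 'v \<Rightarrow> nat" where
  "degree p v = card {e \<in> edges p. v \<in> e}"

definition leaf :: "'v position \<Rightarrow> 'v \<Rightarrow> bool" where
  "leaf p v \<longleftrightarrow> v \<in> verts p \<and> degree p v \<le> 1"

definition tree_nim_position :: "'v position \<Rightarrow> bool" where
  "tree_nim_position p \<longleftrightarrow> is_tree p \<and> (\<forall>v \<in> verts p. vsize p v > 0)"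

definition set_size :: "'v position \<Rightarrow> 'v \<Rightarrow> nat \<Rightarrow> 'v position" where
  "set_size p v s =
     (if s = 0
      then \<lparr>verts = verts p - {v}, edges = {e \<in> edges p. v \<notin> e}, vsize = (vsize p)(v := 0)\<rparr>
      else p\<lparr>vsize := (vsize p)(v := s)\<rparr>)"

definition nim_move :: "'v position \<Rightarrow> 'v position \<Rightarrow> bool" where
  "nim_move p q \<longleftrightarrow> tree_nim_position p \<and>
     (\<exists>v s. leaf p v \<and> s < vsize p v \<and> q = set_size p v s)"

definition total_size :: "'v position \<Rightarrow> nat" where
  "total_size p = (\<Sum>v \<in> verts p. vsize p v)"

lemma nim_move_total_size:
  assumes "nim_move p q"
  shows "total_size q < total_size p"
proof -
  from assms obtain v s where p: "tree_nim_position p" and v: "v \<in> verts p"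
    and s: "s < vsize p v" and q: "q = set_size p v s"
    by (auto simp: nim_move_def leaf_def)
  have fin: "finite (verts p)"
    using p by (simp add: tree_nim_position_def is_tree_def simple_graph_def)
  have split: "(\<Sum>u \<in> verts p. f u) = f v + (\<Sum>u \<in> verts p - {v}. f u)" for f :: "'a \<Rightarrow> nat"
    using fin v by (rule sum.remove)
  have "(\<Sum>u \<in> verts p - {v}. ((vsize p)(v := s)) u) = (\<Sum>u \<in> verts p - {v}. vsize p u)" for s
    by (rule sum.cong) auto
  then show ?thesis
    using s split[of "vsize p"] split[of "(vsize p)(v := s)"]
    unfolding q set_size_def total_size_def by (auto simp del: fun_upd_apply simp: fun_upd_same)
qed

declare conj_cong [fundef_cong]

function P_position :: "'v position \<Rightarrow> bool" where
  "P_position p \<longleftrightarrow> \<not> (\<exists>q. nim_move p q \<and> P_position q)"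
  by auto
termination
  by (relation "measure total_size") (auto intro: nim_move_total_size)

declare conj_cong [fundef_cong del]
declare P_position.simps [simp del]

datatype tripod_vertex = Center | Leg1 | Leg2 | Leg3

definition tripod :: "nat \<Rightarrow> nat \<times> nat \<times> nat \<Rightarrow> tripod_vertex position" where
  "tripod n = (\<lambda>(a, b, c).
     \<lparr>verts = {Center, Leg1, Leg2, Leg3},
      edges = {{Center, Leg1}, {Center, Leg2}, {Center, Leg3}},
      vsize = (\<lambda>v. case v of Center \<Rightarrow> n | Leg1 \<Rightarrow> a | Leg2 \<Rightarrow> b | Leg3 \<Rightarrow> c)\<rparr>)"

lemma graph_cycle_two_neighbours:
  assumes "graph_cycle p xs" and "x \<in> set xs"
  obtains u w where "u \<noteq> w" "{x, u} \<in> edges p" "{x, w} \<in> edges p"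
proof -
  let ?n = "length xs"
  have n: "?n \<ge> 3" and d: "distinct xs"
    and e: "\<And>i. i < ?n \<Longrightarrow> {xs ! i, xs ! (Suc i mod ?n)} \<in> edges p"
    using assms(1) by (auto simp: graph_cycle_def)
  obtain i where i: "i < ?n" "x = xs ! i"
    using assms(2) by (auto simp: in_set_conv_nth)
  define j where "j = (if i = 0 then ?n - 1 else i - 1)"
  have j: "j < ?n" "Suc j mod ?n = i" using i n by (auto simp: j_def)
  define k where "k = Suc i mod ?n"
  have k: "k < ?n" using n unfolding k_def by (intro mod_less_divisor) linarith
  have "j \<noteq> k"
  proof (cases "Suc i = ?n")
    case True
    then have "k = 0" by (simp add: k_def)
    then show ?thesis using True n by (auto simp: j_def)
  next
    case False
    then have "k = Suc i" using i by (simp add: k_def)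
    then show ?thesis using False n i by (auto simp: j_def)
  qed
  then have "xs ! j \<noteq> xs ! k" using d j k by (simp add: nth_eq_iff_index_eq)
  moreover have "{x, xs ! j} \<in> edges p" using e[OF j(1)] j i by (simp add: insert_commute)
  moreover have "{x, xs ! k} \<in> edges p" using e[OF i(1)] i by (simp add: k_def)
  ultimately show thesis by (rule that)
qed

lemma tree_nim_position_tripod:
  assumes "n > 0" "a > 0" "b > 0" "c > 0"
  shows "tree_nim_position (tripod n (a, b, c))"
proof -
  let ?p = "tripod n (a, b, c)"
  have simple: "simple_graph ?p"
    by (auto simp: simple_graph_def tripod_def)
  have "(Center, v) \<in> (adj_rel ?p)\<^sup>*" "(v, Center) \<in> (adj_rel ?p)\<^sup>*" for v
    by (cases v; auto simp: adj_rel_def tripod_def insert_commute intro!: r_into_rtrancl)+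
  then have conn: "graph_connected ?p"
    by (meson graph_connected_def rtrancl_trans)
  have "\<not> graph_cycle ?p xs" for xs
  proof
    assume c: "graph_cycle ?p xs"
    then have "x = Center" if "x \<in> set xs" for x
      using that by (rule graph_cycle_two_neighbours)
        (cases x; auto simp: tripod_def doubleton_eq_iff)
    then have "card (set xs) \<le> card {Center}" by (intro card_mono) auto
    moreover have "card (set xs) \<ge> 3"
      using c by (simp add: graph_cycle_def distinct_card)
    ultimately show False by simp
  qed
  then have "is_tree ?p" using simple conn by (simp add: is_tree_def)
  then show ?thesis using assms
    by (auto simp: tree_nim_position_def tripod_def)
qed

lemma tree_nim_position_nim_move:
  assumes "nim_move p q"
  shows "tree_nim_position q"
proof -
  from assms obtain v s where p: "tree_nim_position p" and leaf: "leaf p v"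
    and q: "q = set_size p v s"
    by (auto simp: nim_move_def)
  have simple: "simple_graph p" and conn: "graph_connected p" and acyc: "\<not> graph_cycle p xs"
    and pos: "u \<in> verts p \<Longrightarrow> vsize p u > 0" for xs u
    using p by (auto simp: tree_nim_position_def is_tree_def)
  show ?thesis
  proof (cases "s = 0")
    case False
    then have eqs: "verts q = verts p" "edges q = edges p" "vsize q = (vsize p)(v := s)"
      by (simp_all add: q set_size_def)
    show ?thesis using False simple conn acyc pos
      by (simp add: tree_nim_position_def is_tree_def simple_graph_def graph_connected_def
          graph_cycle_def adj_rel_def eqs)
  next
    case True
    then have eqs: "verts q = verts p - {v}" "edges q = {e \<in> edges p. v \<notin> e}"
      "vsize q = (vsize p)(v := 0)"
      by (simp_all add: q set_size_def)
    have simple_q: "simple_graph q"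
      using simple by (auto simp: simple_graph_def eqs)
    have acyc_q: "\<not> graph_cycle q xs" for xs
      using acyc[of xs] by (auto simp: graph_cycle_def eqs)
    have "edges p \<subseteq> Pow (verts p)" "finite (verts p)"
      using simple by (auto simp: simple_graph_def)
    then have "finite (edges p)" by (meson finite_Pow_iff finite_subset)
    then have fin: "finite {e \<in> edges p. v \<in> e}" by simp
    have uniq: "x = y" if "{v, x} \<in> edges p" "{v, y} \<in> edges p" for x y
    proof -
      have "{v, x} = {v, y}"
        using leaf that fin unfolding leaf_def degree_def One_nat_def
        by (auto simp: card_le_Suc0_iff_eq)
      then show ?thesis by (auto simp: doubleton_eq_iff)
    qed
    have "{x} \<notin> edges p" for x using simple by (force simp: simple_graph_def)
    then have irrefl: "{x, x} \<notin> edges p" for x by simp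
    have reach: "if y = v then \<forall>x. {v, x} \<in> edges p \<longrightarrow> (u, x) \<in> (adj_rel q)\<^sup>*
                 else (u, y) \<in> (adj_rel q)\<^sup>*"
      if "(u, y) \<in> (adj_rel p)\<^sup>*" "u \<noteq> v" for u y
      using that(1)
    proof (induction rule: rtrancl_induct)
      case base
      then show ?case using that(2) by simp
    next
      case (step y z)
      have yz: "{y, z} \<in> edges p" using step.hyps(2) by (simp add: adj_rel_def)
      consider "y = v" | "z = v" "y \<noteq> v" | "y \<noteq> v" "z \<noteq> v" by blast
      then show ?case
      proof cases
        case 1
        then have "z \<noteq> v" using yz irrefl by auto
        then show ?thesis using 1 yz step.IH by simp
      next
        case 2
        then have "{v, y} \<in> edges p" using yz by (simp add: insert_commute)
        then show ?thesis using 2 uniq step.IH by auto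
      next
        case 3
        then have "(y, z) \<in> adj_rel q" using yz by (auto simp: adj_rel_def eqs)
        then show ?thesis using 3 step.IH by auto
      qed
    qed
    have "graph_connected q"
      unfolding graph_connected_def
    proof (intro ballI)
      fix u w assume "u \<in> verts q" "w \<in> verts q"
      then have "(u, w) \<in> (adj_rel p)\<^sup>*" "u \<noteq> v" "w \<noteq> v"
        using conn by (auto simp: graph_connected_def eqs)
      then show "(u, w) \<in> (adj_rel q)\<^sup>*" using reach[of u w] by simp
    qed
    then show ?thesis using simple_q acyc_q pos
      by (simp add: tree_nim_position_def is_tree_def eqs)
  qed
qed

end

(* The proof is the Bouton argument for three-pile nim, once the positions with a deleted leg are
   understood: a two-vertex path with sizes n, b is P iff n = b, and a three-vertex path with middle
   n and ends a, b is P iff a = b and a is not n.  A winning nim move from a tripod with nonzero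
   nim-sum can only fail if it deletes a leg and leaves ends a = b = n; if the third leg c is then
   larger than n it is moved to n, and if c < n = 2^k - 1 then one n is moved to n XOR c < n
   instead. *)
theory Submission
  imports Defs
begin

section \<open>Binary digits, order, and nim-sums\<close>

section \<open>Nim-sums\<close>

text \<open>The highest differing bit decides the order: after shifting out the bits below
  \<open>m\<close>, the numbers differ only in their last bit, and the shift is monotone.\<close>

lemma nat_less_by_bit:
  fixes x y :: nat
  assumes "bit x m" "\<not> bit y m" and above: "\<And>j. j > m \<Longrightarrow> bit x j = bit y j"
  shows "y < x"
proof -
  have "drop_bit (Suc m) x = drop_bit (Suc m) y"
    by (rule bit_eqI) (simp add: bit_drop_bit_eq above)
  moreover have "drop_bit m z = of_bool (bit z m) + 2 * drop_bit (Suc m) z" for z :: nat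
    by (simp add: bit_iff_odd_drop_bit drop_bit_Suc drop_bit_half mod2_eq_if [symmetric])
  ultimately have "drop_bit m y < drop_bit m x"
    using assms(1,2) by simp
  then show ?thesis
    by (metis div_le_mono drop_bit_eq_div linorder_not_less)
qed

lemma bit_nat_highest:
  fixes s :: nat
  assumes "s \<noteq> 0"
  obtains m where "bit s m" "\<And>j. j > m \<Longrightarrow> \<not> bit s j"
proof -
  have bound: "j \<le> s" if "bit s j" for j
  proof (rule ccontr)
    assume "\<not> j \<le> s"
    then have "s < 2 ^ j" using less_exp [of j] by linarith
    then show False using that by (simp add: bit_iff_odd)
  qed
  obtain i where i: "bit s i" using assms by (auto simp: bit_eq_iff)
  show thesis
  proof (rule that)
    show "bit s (Greatest (bit s))" using i bound by (rule GreatestI_nat)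
    show "\<not> bit s j" if "j > Greatest (bit s)" for j
      using Greatest_le_nat [of "bit s" j s] bound that by fastforce
  qed
qed

text \<open>Bouton's winning move. The top bit of the nim-sum is set in an odd number of the
  summands; replacing a summand that has it by the nim-sum of the other two clears this bit and
  keeps all higher ones.\<close>

lemma nim_sum_decrease:
  fixes a b c :: nat
  assumes "a XOR b XOR c \<noteq> 0"
  shows "b XOR c < a \<or> a XOR c < b \<or> a XOR b < c"
proof -
  obtain m where m: "bit (a XOR b XOR c) m" "\<And>j. j > m \<Longrightarrow> \<not> bit (a XOR b XOR c) j"
    using bit_nat_highest [OF assms] by blast
  consider "bit a m" "bit b m = bit c m" | "bit b m" "bit a m = bit c m"
    | "bit c m" "bit a m = bit b m"
    using m(1) by (auto simp: bit_xor_iff)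
  then show ?thesis
  proof cases
    case 1
    then have "b XOR c < a" using m(2) by (intro nat_less_by_bit [of _ m]) (auto simp: bit_xor_iff)
    then show ?thesis by simp
  next
    case 2
    then have "a XOR c < b" using m(2) by (intro nat_less_by_bit [of _ m]) (auto simp: bit_xor_iff)
    then show ?thesis by simp
  next
    case 3
    then have "a XOR b < c" using m(2) by (intro nat_less_by_bit [of _ m]) (auto simp: bit_xor_iff)
    then show ?thesis by simp
  qed
qed

lemma xor_eq_0_iff_nat: "a XOR b = 0 \<longleftrightarrow> a = b" for a b :: nat
  by (auto simp: bit_eq_iff bit_xor_iff)

lemma xor_rotate_eq_0_iff:
  fixes a b c :: nat
  shows "a XOR b XOR c = 0 \<longleftrightarrow> a = b XOR c" "a XOR b XOR c = 0 \<longleftrightarrow> b = a XOR c"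
    "a XOR b XOR c = 0 \<longleftrightarrow> c = a XOR b"
  by (auto simp: bit_eq_iff bit_xor_iff)

text \<open>Here the form of \<open>n\<close> enters: \<open>n\<close> consists of \<open>k\<close>
  ones, so XOR with \<open>n\<close> complements within \<open>k\<close> bits and cannot exceed
  \<open>n\<close>.\<close>

lemma mask_xor_less:
  fixes c n :: nat
  assumes "n = 2 ^ k - 1" "0 < c" "c < n"
  shows "n XOR c < n"
proof -
  have "take_bit k (n XOR c) = n XOR c"
    using assms by (simp add: take_bit_xor take_bit_nat_eq_self)
  then have "n XOR c < 2 ^ k" by (simp only: take_bit_nat_eq_self_iff)
  moreover have "n XOR c \<noteq> n"
    using assms(2) xor_rotate_eq_0_iff [of n n c] by auto
  ultimately show ?thesis using assms(1) by simp
qed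

section \<open>Subpositions of a tripod encoded by size functions\<close>

section \<open>Positions on the tripod\<close>

text \<open>Size 0 encodes a deleted vertex.\<close>

definition star :: "(tripod_vertex \<Rightarrow> nat) \<Rightarrow> tripod_vertex position" where
  "star f = \<lparr>verts = {v. f v > 0},
    edges = (\<lambda>l. {Center, l}) ` {l. l \<noteq> Center \<and> f l > 0 \<and> f Center > 0}, vsize = f\<rparr>"

text \<open>Without the center there are no edges, so connectedness leaves room for at most one
  vertex.\<close>

definition star_tree :: "(tripod_vertex \<Rightarrow> nat) \<Rightarrow> bool" where
  "star_tree f \<longleftrightarrow> f Center > 0 \<or> (\<exists>l. \<forall>v. v \<noteq> l \<longrightarrow> f v = 0)"

text \<open>Only the degree condition is recorded; that \<open>v\<close> is present will follow from
  \<open>s < f v\<close> in a move.\<close>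

definition star_leaf :: "(tripod_vertex \<Rightarrow> nat) \<Rightarrow> tripod_vertex \<Rightarrow> bool" where
  "star_leaf f v \<longleftrightarrow> v \<noteq> Center \<or>
    (\<forall>l l'. l \<noteq> Center \<and> l' \<noteq> Center \<and> f l > 0 \<and> f l' > 0 \<longrightarrow> l = l')"

lemma finite_tripod_vertices: "finite (A :: tripod_vertex set)"
proof (rule finite_subset)
  show "A \<subseteq> {Center, Leg1, Leg2, Leg3}" using tripod_vertex.exhaust by blast
qed simp

lemma tripod_eq_star:
  assumes "n > 0" "a > 0" "b > 0" "c > 0"
  shows "tripod n (a, b, c) = star (case_tripod_vertex n a b c)"
proof -
  have "{v. (case v of Center \<Rightarrow> n | Leg1 \<Rightarrow> a | Leg2 \<Rightarrow> b | Leg3 \<Rightarrow> c) > 0}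
      = {Center, Leg1, Leg2, Leg3}"
  proof (intro set_eqI)
    show "x \<in> {v. (case v of Center \<Rightarrow> n | Leg1 \<Rightarrow> a | Leg2 \<Rightarrow> b | Leg3 \<Rightarrow> c) > 0}
      \<longleftrightarrow> x \<in> {Center, Leg1, Leg2, Leg3}" for x
      using assms by (cases x) simp_all
  qed
  moreover have "{l. l \<noteq> Center \<and>
      (case l of Center \<Rightarrow> n | Leg1 \<Rightarrow> a | Leg2 \<Rightarrow> b | Leg3 \<Rightarrow> c) > 0 \<and> n > 0} = {Leg1, Leg2, Leg3}"
  proof (intro set_eqI)
    show "x \<in> {l. l \<noteq> Center \<and>
        (case l of Center \<Rightarrow> n | Leg1 \<Rightarrow> a | Leg2 \<Rightarrow> b | Leg3 \<Rightarrow> c) > 0 \<and> n > 0}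
      \<longleftrightarrow> x \<in> {Leg1, Leg2, Leg3}" for x
      using assms by (cases x) simp_all
  qed
  ultimately show ?thesis by (simp add: tripod_def star_def)
qed

text \<open>The gain of the encoding: deletion and reduction become the same function update. Since
  deletion also resets the size to 0, the records agree exactly.\<close>

lemma set_size_star:
  assumes "f v > 0"
  shows "set_size (star f) v s = star (f(v := s))"
proof (cases "s = 0")
  case True
  have "{u. f u > 0} - {v} = {u. (f(v := 0)) u > 0}"
    by auto
  moreover have "{e \<in> (\<lambda>l. {Center, l}) ` A. v \<notin> e}
      = (\<lambda>l. {Center, l}) ` {l \<in> A. v \<noteq> Center \<and> v \<noteq> l}" for A
    by blast
  moreover have "{l \<in> {l. l \<noteq> Center \<and> f l > 0 \<and> f Center > 0}. v \<noteq> Center \<and> v \<noteq> l}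
      = {l. l \<noteq> Center \<and> (f(v := 0)) l > 0 \<and> (f(v := 0)) Center > 0}"
    by auto
  ultimately show ?thesis using True
    by (simp add: set_size_def star_def del: fun_upd_apply mem_Collect_eq)
next
  case False
  then have "(f(v := s)) u > 0 \<longleftrightarrow> f u > 0" for u using assms by simp
  then show ?thesis using False by (simp add: set_size_def star_def del: fun_upd_apply)
qed

lemma leaf_star: "leaf (star f) v \<longleftrightarrow> f v > 0 \<and> star_leaf f v"
proof (cases "f v > 0")
  case True
  let ?E = "{e \<in> edges (star f). v \<in> e}"
  have "finite ?E"
    by (rule finite_subset [OF subset_UNIV]) (simp add: finite_tripod_vertices Finite_Set.finite_set)
  \<comment> \<open>Comparing incident edges pairwise avoids counting them.\<close>
  then have "degree (star f) v \<le> 1 \<longleftrightarrow> (\<forall>x\<in>?E. \<forall>y\<in>?E. x = y)"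
    unfolding degree_def One_nat_def by (rule card_le_Suc0_iff_eq)
  also have "\<dots> \<longleftrightarrow> star_leaf f v"
  proof (cases "v = Center")
    case c: True
    have inj: "{Center, x} = {Center, y} \<longleftrightarrow> x = y" for x y
      by (auto simp: doubleton_eq_iff)
    have "?E = (\<lambda>l. {Center, l}) ` {l. l \<noteq> Center \<and> f l > 0}" (is "_ = _ ` ?L")
      using True c by (auto simp: star_def)
    then have "(\<forall>x\<in>?E. \<forall>y\<in>?E. x = y) \<longleftrightarrow> (\<forall>l\<in>?L. \<forall>l'\<in>?L. l = l')"
      by (simp only: ball_simps inj)
    also have "\<dots> \<longleftrightarrow> star_leaf f v"
      using c unfolding star_leaf_def by blast
    finally show ?thesis .
  next
    case False
    then show ?thesis by (auto simp: star_leaf_def star_def)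
  qed
  finally show ?thesis using True by (simp add: leaf_def star_def)
qed (simp add: leaf_def star_def)

lemma tree_nim_position_star:
  assumes "star_tree f"
  shows "tree_nim_position (star f)"
proof -
  let ?p = "star f"
  have simple: "simple_graph ?p"
    by (auto simp: simple_graph_def star_def finite_tripod_vertices)
  have conn: "graph_connected ?p"
  proof (cases "f Center > 0")
    case True
    have "(Center, v) \<in> (adj_rel ?p)\<^sup>* \<and> (v, Center) \<in> (adj_rel ?p)\<^sup>*" if "v \<in> verts ?p" for v
    proof (cases "v = Center")
      case False
      then have "{Center, v} \<in> edges ?p" using True that by (auto simp: star_def)
      then show ?thesis by (auto simp: adj_rel_def insert_commute)
    qed simp
    then show ?thesis by (meson graph_connected_def rtrancl_trans)
  next
    case False
    then obtain l where "\<And>v. v \<noteq> l \<Longrightarrow> f v = 0" using assms by (auto simp: star_tree_def)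
    then have "verts ?p \<subseteq> {l}" by (force simp: star_def)
    then show ?thesis by (auto simp: graph_connected_def)
  qed
  have nbr: "u = Center" if e: "{x, u} \<in> edges ?p" "x \<noteq> Center" for x u
  proof -
    obtain l where "{x, u} = {Center, l}" using e(1) by (auto simp: star_def)
    then show ?thesis using e(2) by (simp add: doubleton_eq_iff)
  qed
  \<comment> \<open>A vertex on a cycle has two distinct neighbours, but a leg has at most the
    center, so a cycle would have just one vertex.\<close>
  have "\<not> graph_cycle ?p xs" for xs
  proof
    assume c: "graph_cycle ?p xs"
    then have "x = Center" if "x \<in> set xs" for x
      using that by (rule graph_cycle_two_neighbours) (metis nbr)
    then have "card (set xs) \<le> card {Center}" by (intro card_mono) auto
    moreover have "card (set xs) \<ge> 3"
      using c by (simp add: graph_cycle_def distinct_card)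
    ultimately show False by simp
  qed
  then have "is_tree ?p" using simple conn by (simp add: is_tree_def)
  then show ?thesis by (simp add: tree_nim_position_def star_def)
qed

lemma P_position_star:
  assumes "star_tree f"
  shows "P_position (star f) \<longleftrightarrow>
    (\<forall>v s. star_leaf f v \<and> s < f v \<longrightarrow> \<not> P_position (star (f(v := s))))"
proof -
  have "vsize (star f) = f" by (simp add: star_def)
  then have "nim_move (star f) q \<longleftrightarrow> (\<exists>v s. star_leaf f v \<and> s < f v \<and> q = star (f(v := s)))" for q
    unfolding nim_move_def using tree_nim_position_star [OF assms]
    by (auto simp: leaf_star set_size_star) (metis set_size_star gr_zeroI not_less0)+
  then show ?thesis by (subst P_position.simps) metis
qed

section \<open>Outcomes of single vertices and of paths\<close>

lemma P_position_single:
  assumes "\<And>v. v \<noteq> l \<Longrightarrow> f v = 0"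
  shows "P_position (star f) \<longleftrightarrow> f l = 0"
proof -
  have tree: "star_tree g" if "\<And>v. v \<noteq> l \<Longrightarrow> g v = 0" for g
    using that by (auto simp: star_tree_def)
  have leaf: "star_leaf f l" unfolding star_leaf_def using assms by (metis less_numeral_extra(3))
  have empty: "P_position (star g)" if "\<And>v. g v = 0" for g
    using that by (subst P_position_star) (auto intro: tree)
  show ?thesis
  proof (cases "f l = 0")
    case True
    then have "f v = 0" for v using assms by (cases "v = l") auto
    then show ?thesis using empty True by simp
  next
    case False
    have "P_position (star (f(l := 0)))" using assms by (intro empty) simp
    then have "\<not> P_position (star f)"
      using P_position_star [OF tree, of f] assms leaf False by blast
    then show ?thesis using False by simp
  qed
qed

text \<open>Both vertices are leaves, so this is two-pile nim: unequal sizes are equalised, and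
  every move from equal sizes destroys equality.\<close>

lemma P_position_edge:
  assumes "f Center > 0" "f l > 0" "l \<noteq> Center" "\<And>v. v \<noteq> l \<Longrightarrow> v \<noteq> Center \<Longrightarrow> f v = 0"
  shows "P_position (star f) \<longleftrightarrow> f Center = f l"
  using assms
proof (induction "f Center + f l" arbitrary: f rule: less_induct)
  case less
  have step: "P_position (star f) \<longleftrightarrow>
    (\<forall>v s. star_leaf f v \<and> s < f v \<longrightarrow> \<not> P_position (star (f(v := s))))"
    using less.prems by (intro P_position_star) (simp add: star_tree_def)
  have leaf: "star_leaf f v" for v
    unfolding star_leaf_def using less.prems by (metis less_numeral_extra(3))
  have C: "P_position (star (f(Center := s))) \<longleftrightarrow> s = f l" if "s < f Center" for s
  proof (cases "s = 0")
    \<comment> \<open>Deletion leaves one nonempty pile, which is not P; this matches the formula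
      because \<open>f l\<close> is not 0.\<close>
    case True
    then show ?thesis
      using P_position_single [of l "f(Center := s)"] less.prems by auto
  next
    case False
    then show ?thesis using less.hyps [of "f(Center := s)"] less.prems that by simp
  qed
  have L: "P_position (star (f(l := s))) \<longleftrightarrow> s = f Center" if "s < f l" for s
  proof (cases "s = 0")
    case True
    then show ?thesis
      using P_position_single [of Center "f(l := s)"] less.prems by auto
  next
    case False
    then show ?thesis using less.hyps [of "f(l := s)"] less.prems that by auto
  qed
  show ?case
  proof
    assume P: "P_position (star f)"
    show "f Center = f l"
      using P step leaf C L by (metis nat_neq_iff)
  next
    assume eq: "f Center = f l"
    have "\<not> P_position (star (f(v := s)))" if "s < f v" for v s
      using that C L eq less.prems by (metis less_irrefl not_less0)
    then show "P_position (star f)" using step by blast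
  qed
qed

text \<open>The middle is locked while both ends remain. If an end equals the middle, deleting the
  other end wins; otherwise deletions lose and the ends behave like two nim piles. Only the ends
  shrink, hence the induction measure.\<close>

lemma P_position_path:
  assumes "f Center > 0" "f l > 0" "f l' > 0" "l \<noteq> Center" "l' \<noteq> Center" "l \<noteq> l'"
    and "\<And>v. v \<noteq> l \<Longrightarrow> v \<noteq> l' \<Longrightarrow> v \<noteq> Center \<Longrightarrow> f v = 0"
  shows "P_position (star f) \<longleftrightarrow> f l = f l' \<and> f l \<noteq> f Center"
  using assms
proof (induction "f l + f l'" arbitrary: f rule: less_induct)
  case less
  have step: "P_position (star f) \<longleftrightarrow>
    (\<forall>v s. star_leaf f v \<and> s < f v \<longrightarrow> \<not> P_position (star (f(v := s))))"
    using less.prems by (intro P_position_star) (simp add: star_tree_def)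
  have leaf: "star_leaf f v \<longleftrightarrow> v \<noteq> Center" for v
    unfolding star_leaf_def using less.prems by blast
  have L: "P_position (star (f(l := s))) \<longleftrightarrow>
      (if s = 0 then f l' = f Center else s = f l' \<and> s \<noteq> f Center)" if "s < f l" for s
  proof (cases "s = 0")
    case True
    then show ?thesis using P_position_edge [of "f(l := s)" l'] less.prems by auto
  next
    case False
    then show ?thesis using less.hyps [of "f(l := s)"] less.prems that by simp
  qed
  have L': "P_position (star (f(l' := s))) \<longleftrightarrow>
      (if s = 0 then f l = f Center else s = f l \<and> s \<noteq> f Center)" if "s < f l'" for s
  proof (cases "s = 0")
    case True
    then show ?thesis using P_position_edge [of "f(l' := s)" l] less.prems by auto
  next
    case False
    then show ?thesis using less.hyps [of "f(l' := s)"] less.prems that by auto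
  qed
  have "P_position (star f) \<longleftrightarrow> (\<forall>s < f l. \<not> P_position (star (f(l := s)))) \<and>
      (\<forall>s < f l'. \<not> P_position (star (f(l' := s))))"
    using step leaf less.prems by (metis not_less0)
  also have "\<dots> \<longleftrightarrow> f l = f l' \<and> f l \<noteq> f Center"
  proof
    assume A: "(\<forall>s < f l. \<not> P_position (star (f(l := s)))) \<and>
      (\<forall>s < f l'. \<not> P_position (star (f(l' := s))))"
    then have "f l' \<noteq> f Center" "f l \<noteq> f Center"
      using L [of 0] L' [of 0] less.prems by auto
    moreover have "\<not> f l' < f l" "\<not> f l < f l'"
      using A L [of "f l'"] L' [of "f l"] calculation less.prems by auto
    ultimately show "f l = f l' \<and> f l \<noteq> f Center" by linarith
  next
    assume "f l = f l' \<and> f l \<noteq> f Center"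
    then show "(\<forall>s < f l. \<not> P_position (star (f(l := s)))) \<and>
      (\<forall>s < f l'. \<not> P_position (star (f(l' := s))))"
      using L L' by (metis less_irrefl)
  qed
  finally show ?case .
qed

text \<open>The first three conjuncts are the deletions of a leg, evaluated by the path criterion;
  the others are reductions that keep three legs. The center is no leaf, so \<open>n\<close> stays
  fixed.\<close>

lemma P_position_tripod:
  assumes "n > 0" "a > 0" "b > 0" "c > 0"
  shows "P_position (tripod n (a, b, c)) \<longleftrightarrow>
    \<not> (b = c \<and> b \<noteq> n) \<and> \<not> (a = c \<and> a \<noteq> n) \<and> \<not> (a = b \<and> a \<noteq> n) \<and>
    (\<forall>s. 0 < s \<and> s < a \<longrightarrow> \<not> P_position (tripod n (s, b, c))) \<and>
    (\<forall>s. 0 < s \<and> s < b \<longrightarrow> \<not> P_position (tripod n (a, s, c))) \<and>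
    (\<forall>s. 0 < s \<and> s < c \<longrightarrow> \<not> P_position (tripod n (a, b, s)))"
proof -
  define f where "f = case_tripod_vertex n a b c"
  have f: "f Center = n" "f Leg1 = a" "f Leg2 = b" "f Leg3 = c" by (simp_all add: f_def)
  have legs: "(\<forall>v. v \<noteq> Center \<longrightarrow> Q v) \<longleftrightarrow> Q Leg1 \<and> Q Leg2 \<and> Q Leg3" for Q
    by (metis tripod_vertex.exhaust tripod_vertex.distinct(1,3,5))
  have upd: "f(Leg1 := s) = case_tripod_vertex n s b c"
    "f(Leg2 := s) = case_tripod_vertex n a s c" "f(Leg3 := s) = case_tripod_vertex n a b s" for s
    by (auto simp: f_def fun_eq_iff split: tripod_vertex.splits)
  have path: "P_position (star (f(l := 0))) \<longleftrightarrow> f l' = f l'' \<and> f l' \<noteq> n"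
    if "{l, l', l''} = {Leg1, Leg2, Leg3}" for l l' l''
  proof -
    \<comment> \<open>The set equation says that the three vertices are the legs in some order; its
      cardinality yields distinctness.\<close>
    have "card {l, l', l''} = 3" by (simp add: that)
    then have dist: "l \<noteq> l'" "l \<noteq> l''" "l' \<noteq> l''" by (auto simp: card_insert_if split: if_splits)
    have cover: "v = l \<or> v = l' \<or> v = l'' \<or> v = Center" for v
      using that by (cases v) blast+
    have ne: "l \<noteq> Center" "l' \<noteq> Center" "l'' \<noteq> Center"
      using that by blast+
    have pos: "f v > 0" for v using assms by (cases v) (simp_all add: f)
    have "(f(l := 0)) v = 0" if "v \<noteq> l'" "v \<noteq> l''" "v \<noteq> Center" for v
      using cover that by auto
    then show ?thesis
      using P_position_path [of "f(l := 0)" l' l''] dist ne pos f(1) assms(1) by simp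
  qed
  have del: "P_position (star (f(Leg1 := 0))) \<longleftrightarrow> b = c \<and> b \<noteq> n"
    "P_position (star (f(Leg2 := 0))) \<longleftrightarrow> a = c \<and> a \<noteq> n"
    "P_position (star (f(Leg3 := 0))) \<longleftrightarrow> a = b \<and> a \<noteq> n"
    using path [of Leg1 Leg2 Leg3] path [of Leg2 Leg1 Leg3] path [of Leg3 Leg1 Leg2]
    by (simp_all add: f insert_commute)
  have red: "s > 0 \<Longrightarrow> star (f(Leg1 := s)) = tripod n (s, b, c)"
    "s > 0 \<Longrightarrow> star (f(Leg2 := s)) = tripod n (a, s, c)"
    "s > 0 \<Longrightarrow> star (f(Leg3 := s)) = tripod n (a, b, s)" for s
    using assms by (simp_all add: upd tripod_eq_star)
  \<comment> \<open>Separates deletion, \<open>s = 0\<close>, from proper reduction.\<close>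
  have below: "(\<forall>s. s < m \<longrightarrow> R s) \<longleftrightarrow> R 0 \<and> (\<forall>s. 0 < s \<and> s < m \<longrightarrow> R s)" if "m > 0"
    for m and R :: "nat \<Rightarrow> bool"
    using that by (metis gr_zeroI)
  have leaf: "star_leaf f v \<longleftrightarrow> v \<noteq> Center" for v
  proof -
    have "Leg1 \<noteq> Center" "Leg2 \<noteq> Center" "f Leg1 > 0" "f Leg2 > 0" "Leg1 \<noteq> Leg2"
      using assms f by simp_all
    then show ?thesis unfolding star_leaf_def by blast
  qed
  have "P_position (tripod n (a, b, c)) \<longleftrightarrow>
      (\<forall>v. v \<noteq> Center \<longrightarrow> (\<forall>s. s < f v \<longrightarrow> \<not> P_position (star (f(v := s)))))"
    using P_position_star [of f] leaf assms f by (auto simp: tripod_eq_star f_def star_tree_def)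
  also have "\<dots> \<longleftrightarrow> (\<forall>s. s < a \<longrightarrow> \<not> P_position (star (f(Leg1 := s)))) \<and>
      (\<forall>s. s < b \<longrightarrow> \<not> P_position (star (f(Leg2 := s)))) \<and>
      (\<forall>s. s < c \<longrightarrow> \<not> P_position (star (f(Leg3 := s))))"
    by (simp only: legs f)
  finally show ?thesis
    using below [OF assms(2)] below [OF assms(3)] below [OF assms(4)] del red by auto
qed

section \<open>The classification for centers of the form 2^k - 1\<close>

section \<open>Mersenne centers\<close>

lemma P_position_tripod_mersenne:
  fixes n k :: nat
  assumes "n > 0" "n = 2 ^ k - 1" "a > 0" "b > 0" "c > 0"
  shows "P_position (tripod n (a, b, c)) \<longleftrightarrow> a XOR b XOR c = 0 \<or> (a = n \<and> b = n \<and> c = n)"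
  using assms(3-)
proof (induction "a + b + c" arbitrary: a b c rule: less_induct)
  case less
  define K where "K a b c \<longleftrightarrow> a XOR b XOR c = 0 \<or> (a = n \<and> b = n \<and> c = n)" for a b c
  have IH: "P_position (tripod n (x, y, z)) \<longleftrightarrow> K x y z"
    if "x + y + z < a + b + c" "x > 0" "y > 0" "z > 0" for x y z
    unfolding K_def using less.hyps that by blast
  \<comment> \<open>The induction hypothesis turns the recursion into pure arithmetic about the
    claimed predicate \<open>K\<close>.\<close>
  have step: "P_position (tripod n (a, b, c)) \<longleftrightarrow>
    \<not> (b = c \<and> b \<noteq> n) \<and> \<not> (a = c \<and> a \<noteq> n) \<and> \<not> (a = b \<and> a \<noteq> n) \<and>
    (\<forall>s. 0 < s \<and> s < a \<longrightarrow> \<not> K s b c) \<and> (\<forall>s. 0 < s \<and> s < b \<longrightarrow> \<not> K a s c) \<and>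
    (\<forall>s. 0 < s \<and> s < c \<longrightarrow> \<not> K a b s)"
    using less.prems IH by (subst P_position_tripod [OF assms(1)]) auto
  have "K a b c" if P: "P_position (tripod n (a, b, c))"
  proof (rule ccontr)
    assume K: "\<not> K a b c"
    have no: "0 < s \<Longrightarrow> s < a \<Longrightarrow> \<not> K s b c" "0 < s \<Longrightarrow> s < b \<Longrightarrow> \<not> K a s c"
      "0 < s \<Longrightarrow> s < c \<Longrightarrow> \<not> K a b s" for s
      using P step by blast+
    have eq: "b = c \<Longrightarrow> b = n" "a = c \<Longrightarrow> a = n" "a = b \<Longrightarrow> a = n"
      using P step by blast+
    consider "b XOR c < a" | "a XOR c < b" | "a XOR b < c"
      using nim_sum_decrease [of a b c] K by (auto simp: K_def)
    \<comment> \<open>Bouton's move reaches nim-sum 0, which \<open>no\<close> forbids unless the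
      new size is 0, that is, unless the other two legs are equal.\<close>
    then have "b = c \<or> a = c \<or> a = b"
      using no by cases (metis K_def xor_rotate_eq_0_iff xor_eq_0_iff_nat gr_zeroI)+
    then consider "b = n" "c = n" | "a = n" "c = n" | "a = n" "b = n"
      using eq by metis
    then show False
    proof cases
      case 1
      \<comment> \<open>If \<open>a < n\<close>, moving the second leg from \<open>n\<close> to
        \<open>n XOR a\<close> makes the nim-sum 0; if \<open>a = n\<close>, then \<open>K\<close>
        holds already; if \<open>a > n\<close>, moving \<open>a\<close> to \<open>n\<close> gives
        three legs \<open>n\<close>. The other two cases are symmetric.\<close>
      then show False
        using K no(1) [of n] no(2) [of "n XOR a"] mask_xor_less [OF assms(2), of a] less.prems
          xor_eq_0_iff_nat [of n a] xor_rotate_eq_0_iff [of a "n XOR a" n]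
        by (cases a n rule: linorder_cases) (auto simp: K_def xor.commute)
    next
      case 2
      then show False
        using K no(2) [of n] no(1) [of "n XOR b"] mask_xor_less [OF assms(2), of b] less.prems
          xor_eq_0_iff_nat [of n b] xor_rotate_eq_0_iff [of "n XOR b" b n]
        by (cases b n rule: linorder_cases) (auto simp: K_def xor.commute)
    next
      case 3
      then show False
        using K no(3) [of n] no(1) [of "n XOR c"] mask_xor_less [OF assms(2), of c] less.prems
          xor_eq_0_iff_nat [of n c] xor_rotate_eq_0_iff [of "n XOR c" n c]
        by (cases c n rule: linorder_cases) (auto simp: K_def xor.commute)
    qed
  qed
  moreover have "P_position (tripod n (a, b, c))" if "K a b c"
  proof (cases "a = n \<and> b = n \<and> c = n")
    case True
    \<comment> \<open>The two copies of \<open>n\<close> cancel, so the nim-sum is \<open>s\<close>,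
      which is positive. Deleting a leg leaves ends equal to the center, which is not P.\<close>
    have "\<not> K s n n" "\<not> K n s n" "\<not> K n n s" if "0 < s" "s < n" for s
      using that xor_rotate_eq_0_iff(1) [of s n n] xor_rotate_eq_0_iff(2) [of n s n]
        xor_rotate_eq_0_iff(3) [of n n s]
      by (auto simp: K_def)
    then show ?thesis using True step by blast
  next
    case False
    then have xor0: "a XOR b XOR c = 0" using that unfolding K_def by blast
    \<comment> \<open>Two equal legs would cancel and force the third to be 0; so no deletion
      reaches a P-position.\<close>
    have "b \<noteq> c" "a \<noteq> c" "a \<noteq> b"
      using xor0 less.prems xor_rotate_eq_0_iff [of a b c] by auto
    \<comment> \<open>Nim-sum 0 would determine \<open>s\<close> as \<open>b XOR c\<close>, which is
      \<open>a\<close>; the exceptional triple is excluded by \<open>b \<noteq> c\<close>.\<close>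
    moreover have "\<not> K s b c" if "s < a" for s
      using that xor0 \<open>b \<noteq> c\<close> xor_rotate_eq_0_iff(1) [of s b c] xor_rotate_eq_0_iff(1) [of a b c]
      by (auto simp: K_def)
    moreover have "\<not> K a s c" if "s < b" for s
      using that xor0 \<open>a \<noteq> c\<close> xor_rotate_eq_0_iff(2) [of a s c] xor_rotate_eq_0_iff(2) [of a b c]
      by (auto simp: K_def)
    moreover have "\<not> K a b s" if "s < c" for s
      using that xor0 \<open>a \<noteq> b\<close> xor_rotate_eq_0_iff(3) [of a b s] xor_rotate_eq_0_iff(3) [of a b c]
      by (auto simp: K_def)
    ultimately show ?thesis using step by blast
  qed
  ultimately show ?case by (auto simp: K_def)
qed

theorem mainTheorem9:
  fixes n k :: nat
  assumes "n > 0" and "n = 2 ^ k - 1"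
  shows "\<forall>a b c :: nat. a > 0 \<and> b > 0 \<and> c > 0 \<longrightarrow>
    (P_position (tripod n (a, b, c)) \<longleftrightarrow> a XOR b XOR c = 0 \<or> (a = n \<and> b = n \<and> c = n))"
  using P_position_tripod_mersenne [OF assms] by blast

end
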